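(* Let $\mathfrak{L}=\bigoplus_{\alpha\in G}\mathfrak{L}_\alpha$ be a Lie algebra over a field $\mathbb{F}$ admitting a regular weakly triangular decomposition $\mathfrak{L}=\mathfrak{L}^-\oplus\mathfrak{h}\oplus\mathfrak{L}^+$ over $G=G_-\cup\{0\}\cup G_+$, and assume that $\mathfrak{L}^+=\bigoplus_{\alpha\in G_+}\mathfrak{L}_\alpha$ is completely self-centralizing. If $\tau$ is a ($\mathbb{F}$-linear) Lie algebra automorphism of $\mathfrak{L}$, then $\tau(\mathfrak{h})\subseteq\mathfrak{h}$ and $\tau(\mathfrak{L}_\alpha)\subseteq\mathfrak{L}_{\alpha\circ\tau^{-1}}$ for all $\alpha\in G$, where $\alpha\circ\tau^{-1}\in\mathfrak{h}^*$ is the functional $h\mapsto\alpha(\tau^{-1}(h))$.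
   Context: A Lie algebra $\mathfrak{L}$ over a field $\mathbb{F}$ admits a weakly triangular decomposition if: (1) $\mathfrak{L}=\mathfrak{L}^-\oplus\mathfrak{h}\oplus\mathfrak{L}^+$ for some subalgebras $\mathfrak{L}^{\pm}$ and $\mathfrak{h}$, where $\mathfrak{h}$ is abelian; (2) $\mathfrak{L}^+\neq0$, $[\mathfrak{h},\mathfrak{L}^+]\subseteq\mathfrak{L}^+$, and $\mathfrak{L}^+$ admits a weight space decomposition relative to $\mathfrak{h}$ (under the adjoint representation) with weights $\alpha\neq0$ lying in a free additive semigroup $G_+\subseteq\mathfrak{h}^*$; (3) there is an anti-involution $\sigma$ on $\mathfrak{L}$ (a linear map with $\sigma([x,y])=[\sigma(y),\sigma(x)]$ and $\sigma^2=\mathrm{id}$) such that $\sigma(\mathfrak{L}^+)=\mathfrak{L}^-$ and $\sigma|_{\mathfrak{h}}=\mathrm{id}_{\mathfrak{h}}$; (4) there is a total ordering $>$ on $G_+$ such that for all $\alpha,\beta,\gamma\in G_+$: (a) $\alpha+\beta>\alpha$; and (b) if $\beta\ge\gamma$ then $\alpha+\beta\ge\alpha+\gamma$. For $\alpha\in\mathfrak{h}^*$ let $\mathfrak{L}_\alpha=\{x\in\mathfrak{L}\mid[h,x]=\alpha(h)x\text{ for all }h\in\mathfrak{h}\}$ (possibly $0$); then $\mathfrak{L}_0=\mathfrak{h}$. Let $G_-=\{-\alpha\mid\alpha\in G_+\}$ and $G=G_-\cup\{0\}\cup G_+$, so $\mathfrak{L}^{\pm}=\bigoplus_{\alpha\in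 G_\pm}\mathfrak{L}_\alpha$ and $\mathfrak{L}=\bigoplus_{\alpha\in G}\mathfrak{L}_\alpha$. The decomposition is regular if all the spaces $\mathfrak{L}_\alpha$ are finite-dimensional (in particular $\mathfrak{h}=\mathfrak{L}_0$ is finite-dimensional, so that $\tau(\mathfrak{h})\subseteq\mathfrak{h}$ means $\tau$ restricts to a bijection of $\mathfrak{h}$ and $\alpha\circ\tau^{-1}$ makes sense on $\mathfrak{h}$). A nonzero element $x$ of a Lie algebra $\mathfrak{K}$ over $\mathbb{F}$ is self-centralizing in $\mathfrak{K}$ if, for $y\in\mathfrak{K}$, $[x,y]=0$ implies $y\in\mathbb{F}x$. A Lie algebra $\mathfrak{K}$ with $\dim\mathfrak{K}>1$ is completely self-centralizing if every nonzero element of $\mathfrak{K}$ is self-centralizing in $\mathfrak{K}$. *)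

theory Defs
  imports Complex_Main "HOL-Library.Function_Algebras" "HOL-Library.Multiset"
begin

locale lie_algebra = vector_space scale
  for scale :: "'f::field \<Rightarrow> 'a::ab_group_add \<Rightarrow> 'a" (infixr \<open>*s\<close> 75) +
  fixes bracket :: "'a \<Rightarrow> 'a \<Rightarrow> 'a"
  assumes bracket_add_left: "bracket (x + y) z = bracket x z + bracket y z"
    and bracket_add_right: "bracket x (y + z) = bracket x y + bracket x z"
    and bracket_scale_left: "bracket (c *s x) y = c *s bracket x y"
    and bracket_scale_right: "bracket x (c *s y) = c *s bracket x y"
    and bracket_self: "bracket x x = 0"
    and jacobi: "bracket x (bracket y z) + bracket y (bracket z x) + bracket z (bracket x y) = 0"

text \<open>Free commutative semigroup, without identity: there is a basis \<open>B\<close> such that every element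
  of \<open>S\<close> is, uniquely up to order, a sum of a nonempty finite family of elements of \<open>B\<close>.\<close>

definition free_additive_semigroup :: "'g::comm_monoid_add set \<Rightarrow> bool" where
  "free_additive_semigroup S \<longleftrightarrow>
     (\<exists>B. bij_betw sum_mset {M. M \<noteq> {#} \<and> set_mset M \<subseteq> B} S)"

context lie_algebra
begin

definition subalgebra :: "'a set \<Rightarrow> bool" where
  "subalgebra K \<longleftrightarrow> subspace K \<and> (\<forall>x\<in>K. \<forall>y\<in>K. bracket x y \<in> K)"

definition abelian :: "'a set \<Rightarrow> bool" where
  "abelian K \<longleftrightarrow> (\<forall>x\<in>K. \<forall>y\<in>K. bracket x y = 0)"

text \<open>A functional on the subspace \<open>H\<close> is represented by its extension by \<open>0\<close> outside \<open>H\<close>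
  (not a linear map on the whole algebra).  Equality, \<open>0\<close>, sums and negatives of functionals
  are then those of the function type.\<close>

definition dual_space :: "'a set \<Rightarrow> ('a \<Rightarrow> 'f) set" where
  "dual_space H = {\<alpha>. (\<forall>x\<in>H. \<forall>y\<in>H. \<alpha> (x + y) = \<alpha> x + \<alpha> y) \<and>
                       (\<forall>c. \<forall>x\<in>H. \<alpha> (c *s x) = c * \<alpha> x) \<and>
                       (\<forall>x. x \<notin> H \<longrightarrow> \<alpha> x = 0)}"

definition weight_space :: "'a set \<Rightarrow> ('a \<Rightarrow> 'f) \<Rightarrow> 'a set" where
  "weight_space H \<alpha> = {x. \<forall>h\<in>H. bracket h x = \<alpha> h *s x}"

definition internal_direct_sum :: "'i set \<Rightarrow> ('i \<Rightarrow> 'a set) \<Rightarrow> 'a set \<Rightarrow> bool" where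
  "internal_direct_sum I V W \<longleftrightarrow>
     (\<forall>i\<in>I. subspace (V i)) \<and>
     W = span (\<Union>i\<in>I. V i) \<and>
     (\<forall>J x. finite J \<and> J \<subseteq> I \<and> (\<forall>j\<in>J. x j \<in> V j) \<and> (\<Sum>j\<in>J. x j) = 0
        \<longrightarrow> (\<forall>j\<in>J. x j = 0))"

definition weights_on :: "'a set \<Rightarrow> 'a set \<Rightarrow> ('a \<Rightarrow> 'f) set" where
  "weights_on H K = {\<alpha> \<in> dual_space H. K \<inter> weight_space H \<alpha> \<noteq> {0}}"

definition anti_involution :: "('a \<Rightarrow> 'a) \<Rightarrow> bool" where
  "anti_involution \<sigma> \<longleftrightarrow>
     Vector_Spaces.linear scale scale \<sigma> \<and>
     (\<forall>x y. \<sigma> (bracket x y) = bracket (\<sigma> y) (\<sigma> x)) \<and>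
     \<sigma> \<circ> \<sigma> = id"

text \<open>In the last conjunct, \<open>(\<beta>, \<alpha>) \<in> r\<close> encodes \<open>\<alpha> \<ge> \<beta>\<close>.\<close>

definition weakly_triangular_decomposition ::
    "'a set \<Rightarrow> 'a set \<Rightarrow> 'a set \<Rightarrow> ('a \<Rightarrow> 'f) set \<Rightarrow> bool" where
  "weakly_triangular_decomposition Lm H Lp Gp \<longleftrightarrow>
     subalgebra Lm \<and> subalgebra H \<and> subalgebra Lp \<and> abelian H \<and>
     (\<forall>x. \<exists>!(a, b, c). a \<in> Lm \<and> b \<in> H \<and> c \<in> Lp \<and> x = a + b + c) \<and>
     Lp \<noteq> {0} \<and> (\<forall>h\<in>H. \<forall>x\<in>Lp. bracket h x \<in> Lp) \<and>
     Gp \<subseteq> dual_space H \<and> free_additive_semigroup Gp \<and>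
     weights_on H Lp \<subseteq> Gp - {0} \<and>
     internal_direct_sum (weights_on H Lp) (\<lambda>\<alpha>. Lp \<inter> weight_space H \<alpha>) Lp \<and>
     (\<exists>\<sigma>. anti_involution \<sigma> \<and> \<sigma> ` Lp = Lm \<and> (\<forall>h\<in>H. \<sigma> h = h)) \<and>
     (\<exists>r. linear_order_on Gp r \<and>
        (\<forall>\<alpha>\<in>Gp. \<forall>\<beta>\<in>Gp. (\<alpha>, \<alpha> + \<beta>) \<in> r \<and> \<alpha> + \<beta> \<noteq> \<alpha>) \<and>
        (\<forall>\<alpha>\<in>Gp. \<forall>\<beta>\<in>Gp. \<forall>\<gamma>\<in>Gp. (\<gamma>, \<beta>) \<in> r \<longrightarrow> (\<alpha> + \<gamma>, \<alpha> + \<beta>) \<in> r))"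

definition finite_dimensional :: "'a set \<Rightarrow> bool" where
  "finite_dimensional V \<longleftrightarrow> (\<exists>B. finite B \<and> V = span B)"

definition regular_weakly_triangular_decomposition ::
    "'a set \<Rightarrow> 'a set \<Rightarrow> 'a set \<Rightarrow> ('a \<Rightarrow> 'f) set \<Rightarrow> bool" where
  "regular_weakly_triangular_decomposition Lm H Lp Gp \<longleftrightarrow>
     weakly_triangular_decomposition Lm H Lp Gp \<and>
     (\<forall>\<alpha>\<in>dual_space H. finite_dimensional (weight_space H \<alpha>))"

definition self_centralizing :: "'a set \<Rightarrow> 'a \<Rightarrow> bool" where
  "self_centralizing K x \<longleftrightarrow>
     x \<in> K \<and> x \<noteq> 0 \<and> (\<forall>y\<in>K. bracket x y = 0 \<longrightarrow> (\<exists>c. y = c *s x))"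

text \<open>The library's \<^term>\<open>dim\<close> is \<open>0\<close> on infinite-dimensional subspaces, hence the guard.\<close>

definition completely_self_centralizing :: "'a set \<Rightarrow> bool" where
  "completely_self_centralizing K \<longleftrightarrow>
     subalgebra K \<and> (finite_dimensional K \<longrightarrow> dim K > 1) \<and>
     (\<forall>x\<in>K. x \<noteq> 0 \<longrightarrow> self_centralizing K x)"

definition lie_automorphism :: "('a \<Rightarrow> 'a) \<Rightarrow> bool" where
  "lie_automorphism \<tau> \<longleftrightarrow>
     Vector_Spaces.linear scale scale \<tau> \<and> bij \<tau> \<and>
     (\<forall>x y. \<tau> (bracket x y) = bracket (\<tau> x) (\<tau> y))"

end

end

theory Submission
  imports Defs
begin

text \<open>
  The subalgebra \<open>H\<close> turns out to be intrinsic: it is exactly the set of elements \<open>x\<close> that are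
  ad-locally finite, meaning that every \<open>y\<close> has all its iterates \<open>(ad x)\<^sup>n y\<close> in one
  finite-dimensional subspace.  That property is invariant under automorphisms, hence so is \<open>H\<close>, and
  \<open>[h, \<tau> x] = \<tau> [\<tau>\<^sup>-\<^sup>1 h, x]\<close> then carries weight vectors of weight \<open>\<alpha>\<close> to weight vectors of
  weight \<open>\<alpha> \<circ> \<tau>\<^sup>-\<^sup>1\<close>.

  Elements of \<open>H\<close> are ad-locally finite since weight vectors span the algebra
  (\<open>weight_vectors_span\<close>).  Conversely, let \<open>x\<close> have a nonzero component in \<open>L\<^sup>+\<close>.  Write
  \<open>x = z + \<dots>\<close> with \<open>z\<close> of the highest weight \<open>\<gamma>\<close> occurring in \<open>x\<close> (\<open>leading_term\<close>).  As \<open>L\<^sup>+\<close> has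
  dimension greater than one, it contains a weight vector \<open>y\<close>, of weight \<open>\<beta>\<close> say, that is no multiple
  of \<open>z\<close>.  The leading term of \<open>(ad x)\<^sup>n y\<close> is \<open>(ad z)\<^sup>n y\<close>, of weight \<open>\<beta> + n\<gamma>\<close>, unless it vanishes.
  It does not vanish: by the self-centralizing property \<open>ad z\<close> kills in \<open>L\<^sup>+\<close> only the multiples
  of \<open>z\<close>; \<open>y\<close> is no such multiple, and for \<open>n \<ge> 1\<close> the weight \<open>\<beta> + n\<gamma>\<close> is strictly above \<open>\<gamma>\<close>.
  So the iterates have strictly increasing leading weights and are linearly independent, and \<open>x\<close> is
  not ad-locally finite.  The component in \<open>L\<^sup>-\<close> is excluded by applying this to the image of \<open>x\<close>
  under the automorphism \<open>-\<sigma>\<close>, where \<open>\<sigma>\<close> is the anti-involution.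
\<close>

section \<open>Comparing differences of elements of an ordered semigroup\<close>

locale ordered_cone =
  fixes G :: "'g::ab_group_add set" and r :: "'g rel"
  assumes linear_order: "linear_order_on G r"
    and add_above: "\<alpha> \<in> G \<Longrightarrow> \<beta> \<in> G \<Longrightarrow> (\<alpha>, \<alpha> + \<beta>) \<in> r \<and> \<alpha> + \<beta> \<noteq> \<alpha>"
    and add_mono: "\<alpha> \<in> G \<Longrightarrow> (\<gamma>, \<beta>) \<in> r \<Longrightarrow> (\<alpha> + \<gamma>, \<alpha> + \<beta>) \<in> r"
begin

text \<open>Leading terms have to be compared with components of weight \<open>0\<close>, of negative weight, and of
  weights \<open>\<eta> + \<kappa>\<close> with \<open>\<eta>\<close> and \<open>\<kappa>\<close> of opposite sign.  The order of \<open>G\<close> is therefore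
  extended, by invariance under translations, to a relation on the whole ambient group.\<close>

definition below :: "'g \<Rightarrow> 'g \<Rightarrow> bool" (infix "\<lhd>" 50) where
  "\<eta> \<lhd> \<mu> \<longleftrightarrow> (\<exists>p q. (p, q) \<in> r \<and> p \<noteq> q \<and> \<eta> - \<mu> = p - q)"

lemma order_facts:
  shows "r \<subseteq> G \<times> G" "trans r" "antisym r" "total_on G r"
  using linear_order by (auto simp: order_on_defs)

lemma add_closed: "\<alpha> \<in> G \<Longrightarrow> \<beta> \<in> G \<Longrightarrow> \<alpha> + \<beta> \<in> G"
  using add_above order_facts(1) by blast

lemma below_irrefl: "\<not> \<mu> \<lhd> \<mu>"
  by (auto simp: below_def)

lemma below_add_right: "\<eta> \<lhd> \<mu> \<Longrightarrow> \<eta> + \<kappa> \<lhd> \<mu> + \<kappa>"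
  by (auto simp: below_def)

lemma below_add_left: "\<eta> \<lhd> \<mu> \<Longrightarrow> \<kappa> + \<eta> \<lhd> \<kappa> + \<mu>"
  by (auto simp: below_def)

lemma below_add:
  assumes "\<eta> \<lhd> \<mu>" "\<kappa> \<lhd> \<nu>" shows "\<eta> + \<kappa> \<lhd> \<mu> + \<nu>"
proof -
  obtain p q p' q' where pq: "(p, q) \<in> r" "p \<noteq> q" "\<eta> - \<mu> = p - q"
    and pq': "(p', q') \<in> r" "p' \<noteq> q'" "\<kappa> - \<nu> = p' - q'"
    using assms by (auto simp: below_def)
  have G: "p \<in> G" "q \<in> G" "p' \<in> G" "q' \<in> G" using pq pq' order_facts(1) by auto
  have le1: "(p + p', q + p') \<in> r"
    using add_mono[OF G(3) pq(1)] by (simp add: add.commute)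
  have le2: "(q + p', q + q') \<in> r"
    using add_mono[OF G(2) pq'(1)] .
  have "(p + p', q + q') \<in> r"
    using le1 le2 order_facts(2) by (meson transD)
  moreover have "p + p' \<noteq> q + q'"
  proof
    assume "p + p' = q + q'"
    then have "q + p' = q + q'"
      using le1 le2 order_facts(3) by (metis antisymD)
    then show False using pq'(2) by simp
  qed
  moreover have "(\<eta> + \<kappa>) - (\<mu> + \<nu>) = (p + p') - (q + q')"
    using pq(3) pq'(3) by (metis add_diff_add)
  ultimately show ?thesis unfolding below_def by blast
qed

lemma below_trans:
  assumes "\<eta> \<lhd> \<mu>" "\<mu> \<lhd> \<nu>" shows "\<eta> \<lhd> \<nu>"
proof -
  have "\<eta> + \<mu> \<lhd> \<mu> + \<nu>" using below_add[OF assms] .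
  then have "(\<eta> + \<mu>) + - \<mu> \<lhd> (\<mu> + \<nu>) + - \<mu>" by (rule below_add_right)
  then show ?thesis by (simp add: algebra_simps)
qed

lemma zero_below: "\<gamma> \<in> G \<Longrightarrow> 0 \<lhd> \<gamma>"
  unfolding below_def
  by (rule exI[of _ \<gamma>], rule exI[of _ "\<gamma> + \<gamma>"]) (use add_above[of \<gamma> \<gamma>] in auto)

lemma uminus_below:
  assumes "\<delta> \<in> G" "\<gamma> \<in> G" shows "- \<delta> \<lhd> \<gamma>"
proof -
  have "0 + - \<delta> \<lhd> \<delta> + - \<delta>" by (rule below_add_right[OF zero_below[OF assms(1)]])
  then show ?thesis using below_trans[OF _ zero_below[OF assms(2)]] by simp
qed

lemma below_of_order: "(p, q) \<in> r \<Longrightarrow> p \<noteq> q \<Longrightarrow> p \<lhd> q"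
  unfolding below_def by blast

lemma finite_has_greatest:
  assumes "finite J" "J \<noteq> {}" "J \<subseteq> G"
  shows "\<exists>m\<in>J. \<forall>\<eta>\<in>J. \<eta> \<noteq> m \<longrightarrow> \<eta> \<lhd> m"
  using assms
proof (induction J rule: finite_ne_induct)
  case (insert x J)
  then obtain m where m: "m \<in> J" "\<forall>\<eta>\<in>J. \<eta> \<noteq> m \<longrightarrow> \<eta> \<lhd> m" by auto
  have "x \<noteq> m" using m insert.hyps by auto
  then have "(x, m) \<in> r \<or> (m, x) \<in> r"
    using insert.prems m(1) order_facts(4) by (auto simp: total_on_def)
  then consider "x \<lhd> m" | "m \<lhd> x" using below_of_order \<open>x \<noteq> m\<close> by metis
  then show ?case
  proof cases
    case 1 then show ?thesis using m by auto
  next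
    case 2
    then have "\<forall>\<eta>\<in>J. \<eta> \<lhd> x" using m below_trans by metis
    then show ?thesis by auto
  qed
qed auto

end

section \<open>Weight vectors and ad-local finiteness\<close>

context lie_algebra
begin

lemma bracket_zero [simp]: "bracket 0 x = 0" "bracket x 0 = 0"
  using bracket_scale_left[of 0 0 x] bracket_scale_right[of x 0 0] by simp_all

lemma bracket_minus: "bracket (- x) y = - bracket x y" "bracket x (- y) = - bracket x y"
  using bracket_scale_left[of "-1" x y] bracket_scale_right[of x "-1" y] by simp_all

lemma bracket_anticommute: "bracket x y = - bracket y x"
proof -
  have "0 = bracket (x + y) (x + y)" by (simp only: bracket_self)
  also have "\<dots> = bracket x y + bracket y x"
    unfolding bracket_add_left bracket_add_right by (simp add: bracket_self add.commute)
  finally have "bracket x y + bracket y x = 0" by simp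
  then show ?thesis by (rule eq_neg_iff_add_eq_0[THEN iffD2])
qed

lemma bracket_sum_right: "bracket x (\<Sum>i\<in>I. f i) = (\<Sum>i\<in>I. bracket x (f i))"
  by (induction I rule: infinite_finite_induct) (auto simp: bracket_add_right)

lemma bracket_span:
  assumes "\<And>x y. x \<in> A \<Longrightarrow> y \<in> B \<Longrightarrow> bracket x y \<in> span C"
    and "x \<in> span A" "y \<in> span B"
  shows "bracket x y \<in> span C"
proof -
  have *: "bracket x y \<in> span C" if "x \<in> A" for x
    using assms(3)
    by (induction rule: span_induct_alt)
      (auto simp: bracket_add_right bracket_scale_right that assms(1) intro!: span_add span_scale span_zero)
  show ?thesis
    using assms(2)
    by (induction rule: span_induct_alt)
      (auto simp: bracket_add_left bracket_scale_left * intro!: span_add span_scale span_zero)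
qed

lemma subspace_weight_space: "subspace (weight_space H \<alpha>)"
  by (rule subspaceI)
    (auto simp: weight_space_def bracket_add_right bracket_scale_right scale_right_distrib
      mult.commute)

lemma bracket_weight_space:
  assumes "x \<in> weight_space H \<eta>" "y \<in> weight_space H \<kappa>"
  shows "bracket x y \<in> weight_space H (\<eta> + \<kappa>)"
  unfolding weight_space_def
proof (safe)
  fix h assume h: "h \<in> H"
  have "bracket h (bracket x y) = - bracket x (bracket y h) - bracket y (bracket h x)"
  proof -
    have "bracket h (bracket x y) + (bracket x (bracket y h) + bracket y (bracket h x)) = 0"
      using jacobi[of h x y] by (simp only: add.assoc)
    then show ?thesis by (simp add: eq_neg_iff_add_eq_0[symmetric])
  qed
  also have "bracket y h = - (\<kappa> h *s y)"
    using bracket_anticommute[of y h] assms(2) h by (simp add: weight_space_def)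
  also have "bracket h x = \<eta> h *s x"
    using assms(1) h by (simp add: weight_space_def)
  also have "- bracket x (- (\<kappa> h *s y)) - bracket y (\<eta> h *s x)
      = \<kappa> h *s bracket x y - \<eta> h *s bracket y x"
    by (simp add: bracket_minus bracket_scale_right)
  also have "bracket y x = - bracket x y" by (rule bracket_anticommute)
  finally show "bracket h (bracket x y) = (\<eta> + \<kappa>) h *s bracket x y"
    by (simp add: scale_left_distrib add.commute)
qed

text \<open>Only nonzero components are kept, so that the component of greatest index in the decomposition
  of an element of \<open>L\<^sup>+\<close> is a genuine leading term.\<close>

lemma span_UN_decompose:
  assumes "x \<in> span (\<Union>i\<in>I. V i)" and sub: "\<And>i. i \<in> I \<Longrightarrow> subspace (V i)"
  shows "\<exists>J f. finite J \<and> J \<subseteq> I \<and> (\<forall>j\<in>J. f j \<in> V j \<and> f j \<noteq> 0) \<and> x = (\<Sum>j\<in>J. f j)"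
proof -
  have "\<exists>J f. finite J \<and> J \<subseteq> I \<and> (\<forall>j\<in>J. f j \<in> V j) \<and> x = (\<Sum>j\<in>J. f j)"
    using assms(1)
  proof (induction rule: span_induct_alt)
    case base
    show ?case by (rule exI[of _ "{}"]) auto
  next
    case (step c x y)
    then obtain J f i where J: "finite J" "J \<subseteq> I" "\<forall>j\<in>J. f j \<in> V j" "y = (\<Sum>j\<in>J. f j)"
      and i: "i \<in> I" "x \<in> V i" by auto
    have cx: "c *s x \<in> V i" using i sub subspace_scale by blast
    define g where "g j = (if j \<in> J then f j else 0) + (if j = i then c *s x else 0)" for j
    have "(\<Sum>j\<in>insert i J. g j)
        = (\<Sum>j\<in>insert i J. if j \<in> J then f j else 0) + (\<Sum>j\<in>insert i J. if j = i then c *s x else 0)"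
      by (simp only: g_def sum.distrib)
    also have "(\<Sum>j\<in>insert i J. if j \<in> J then f j else 0) = (\<Sum>j\<in>J. f j)"
      by (rule sum.mono_neutral_cong_right) (use J in auto)
    also have "(\<Sum>j\<in>insert i J. if j = i then c *s x else 0) = c *s x"
      using J(1) by (subst sum.delta) auto
    finally have "c *s x + y = (\<Sum>j\<in>insert i J. g j)" using J(4) by (simp add: add.commute)
    moreover have "\<forall>j\<in>insert i J. g j \<in> V j"
      using J i cx sub by (auto simp: g_def intro!: subspace_add subspace_0)
    ultimately show ?case using J(1,2) i(1) by (intro exI[of _ "insert i J"] exI[of _ g]) auto
  qed
  then obtain J f where J: "finite J" "J \<subseteq> I" "\<forall>j\<in>J. f j \<in> V j" "x = (\<Sum>j\<in>J. f j)" by auto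
  have "x = (\<Sum>j\<in>{j\<in>J. f j \<noteq> 0}. f j)"
    unfolding J(4) by (rule sum.mono_neutral_right) (use J(1) in auto)
  then show ?thesis using J by (intro exI[of _ "{j\<in>J. f j \<noteq> 0}"] exI[of _ f]) auto
qed

text \<open>As for eigenvectors of a single operator: applying \<open>ad h - \<mu> h\<close> to a vanishing sum
  removes the component of weight \<open>\<mu>\<close> and rescales the others.\<close>

lemma weight_vectors_independent:
  assumes "finite J" "J \<subseteq> dual_space H" "\<And>\<eta>. \<eta> \<in> J \<Longrightarrow> f \<eta> \<in> weight_space H \<eta>"
    and "(\<Sum>\<eta>\<in>J. f \<eta>) = 0" and "\<eta> \<in> J"
  shows "f \<eta> = 0"
  using assms
proof (induction J arbitrary: f \<eta> rule: finite_induct)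
  case (insert \<mu> J)
  have w: "bracket h (f \<kappa>) = \<kappa> h *s f \<kappa>" if "\<kappa> \<in> insert \<mu> J" "h \<in> H" for \<kappa> h
    using insert.prems(2)[OF that(1)] that(2) by (simp add: weight_space_def)
  have zero: "f \<kappa> = 0" if \<kappa>: "\<kappa> \<in> J" for \<kappa>
  proof -
    \<comment> \<open>Distinct functionals on \<open>H\<close> vanish outside \<open>H\<close>, so they are told apart inside \<open>H\<close>.\<close>
    have "\<kappa> \<noteq> \<mu>" using \<kappa> insert.hyps by auto
    then obtain h where "\<kappa> h \<noteq> \<mu> h" by auto
    moreover have "\<kappa> \<in> dual_space H" "\<mu> \<in> dual_space H" using insert.prems(1) \<kappa> by auto
    ultimately have h: "h \<in> H" "\<kappa> h - \<mu> h \<noteq> 0" unfolding dual_space_def by (metis (mono_tags, lifting) mem_Collect_eq, simp)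
    have "0 = bracket h (\<Sum>\<eta>\<in>insert \<mu> J. f \<eta>) - \<mu> h *s (\<Sum>\<eta>\<in>insert \<mu> J. f \<eta>)"
      using insert.prems(3) by simp
    also have "\<dots> = (\<Sum>\<eta>\<in>insert \<mu> J. (\<eta> h - \<mu> h) *s f \<eta>)"
      unfolding bracket_sum_right scale_sum_right sum_subtractf[symmetric]
      by (rule sum.cong) (auto simp: w h(1) scale_left_diff_distrib)
    also have "\<dots> = (\<Sum>\<eta>\<in>J. (\<eta> h - \<mu> h) *s f \<eta>)"
      using insert.hyps by simp
    finally have "(\<kappa> h - \<mu> h) *s f \<kappa> = 0"
      using insert.prems \<kappa>
      by (intro insert.IH[of "\<lambda>\<eta>. (\<eta> h - \<mu> h) *s f \<eta>" \<kappa>])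
        (auto intro: subspace_scale[OF subspace_weight_space])
    then show ?thesis using h(2) by simp
  qed
  then have "f \<mu> = 0" using insert.prems(3) insert.hyps by simp
  then show ?case using zero insert.prems(4) by auto
qed simp

lemma weight_vector_in_span_other_weights:
  assumes "\<Lambda> \<subseteq> dual_space H" "\<mu> \<in> dual_space H" "\<mu> \<notin> \<Lambda>"
    and v: "v \<in> weight_space H \<mu>" "v \<in> span (\<Union>\<eta>\<in>\<Lambda>. weight_space H \<eta>)"
  shows "v = 0"
proof -
  obtain J f where J: "finite J" "J \<subseteq> \<Lambda>" "\<forall>j\<in>J. f j \<in> weight_space H j" "v = (\<Sum>j\<in>J. f j)"
    using span_UN_decompose[OF v(2) subspace_weight_space] by blast
  have \<mu>: "\<mu> \<notin> J" using J assms(3) by auto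
  define g where "g = f(\<mu> := - v)"
  have "(\<Sum>j\<in>J. g j) = v"
    unfolding J(4) by (rule sum.cong) (use \<mu> in \<open>auto simp: g_def\<close>)
  then have "(\<Sum>j\<in>insert \<mu> J. g j) = 0" using J(1) \<mu> by (simp add: g_def)
  moreover have "g j \<in> weight_space H j" if "j \<in> insert \<mu> J" for j
    using that J(3) v(1) subspace_neg[OF subspace_weight_space] by (auto simp: g_def)
  ultimately have "g \<mu> = 0"
    using J assms(1,2) by (intro weight_vectors_independent[of "insert \<mu> J" H g]) auto
  then show ?thesis by (simp add: g_def)
qed

lemma dual_space_add: "\<alpha> \<in> dual_space H \<Longrightarrow> \<beta> \<in> dual_space H \<Longrightarrow> \<alpha> + \<beta> \<in> dual_space H"
  by (auto simp: dual_space_def algebra_simps)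

lemma dual_space_uminus: "\<alpha> \<in> dual_space H \<Longrightarrow> - \<alpha> \<in> dual_space H"
  by (auto simp: dual_space_def)

lemma dual_space_zero: "0 \<in> dual_space H"
  by (auto simp: dual_space_def)

definition ad_locally_finite :: "'a \<Rightarrow> bool" where
  "ad_locally_finite x \<longleftrightarrow> (\<forall>y. \<exists>B. finite B \<and> (\<forall>n. (bracket x ^^ n) y \<in> span B))"

lemma ad_locally_finite_automorphism:
  assumes "lie_automorphism \<theta>" "ad_locally_finite x"
  shows "ad_locally_finite (\<theta> x)"
  unfolding ad_locally_finite_def
proof
  fix y
  have lin: "Vector_Spaces.linear scale scale \<theta>" and "surj \<theta>"
    and br: "\<And>x y. \<theta> (bracket x y) = bracket (\<theta> x) (\<theta> y)"
    using assms(1) by (auto simp: lie_automorphism_def bij_def)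
  then obtain y' where y: "y = \<theta> y'" by (metis surjD)
  obtain B where B: "finite B" "\<forall>n. (bracket x ^^ n) y' \<in> span B"
    using assms(2) by (auto simp: ad_locally_finite_def)
  have it: "(bracket (\<theta> x) ^^ n) y = \<theta> ((bracket x ^^ n) y')" for n
    by (induction n) (auto simp: y br)
  have "(bracket (\<theta> x) ^^ n) y \<in> span (\<theta> ` B)" for n
    unfolding it
    using B(2) module_hom.span_image[OF lin[folded module_hom_iff_linear]] by blast
  then show "\<exists>B. finite B \<and> (\<forall>n. (bracket (\<theta> x) ^^ n) y \<in> span B)"
    using B(1) by blast
qed

lemma lie_automorphism_inv:
  assumes "lie_automorphism \<tau>" shows "lie_automorphism (inv \<tau>)"
proof -
  have lin: "Vector_Spaces.linear scale scale \<tau>" and b: "bij \<tau>"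
    and br: "\<And>x y. \<tau> (bracket x y) = bracket (\<tau> x) (\<tau> y)"
    using assms by (auto simp: lie_automorphism_def)
  have r: "\<tau> (inv \<tau> x) = x" and l: "inv \<tau> (\<tau> x) = x" for x
    using b by (simp_all add: bij_def surj_f_inv_f)
  note vs = lin[unfolded Vector_Spaces.linear_iff]
  have "inv \<tau> (x + y) = inv \<tau> x + inv \<tau> y" "inv \<tau> (c *s x) = c *s inv \<tau> x"
    "inv \<tau> (bracket x y) = bracket (inv \<tau> x) (inv \<tau> y)" for c x y
    by (metis vs r l) (metis vs r l, metis br r l)
  then show ?thesis
    using vs b by (auto simp: lie_automorphism_def Vector_Spaces.linear_iff bij_imp_bij_inv)
qed

text \<open>Each weight vector spans an \<open>ad h\<close>-invariant line for \<open>h \<in> H\<close>.\<close>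

lemma ad_locally_finite_of_weight_span:
  assumes "h \<in> H" and all: "\<And>y. y \<in> span (\<Union>\<eta>. weight_space H \<eta>)"
  shows "ad_locally_finite h"
  unfolding ad_locally_finite_def
proof
  fix y
  show "\<exists>B. finite B \<and> (\<forall>n. (bracket h ^^ n) y \<in> span B)"
    using all[of y]
  proof (induction rule: span_induct_alt)
    case base
    have "(bracket h ^^ n) 0 = 0" for n by (induction n) auto
    then show ?case by (intro exI[of _ "{}"]) auto
  next
    case (step c x y)
    then obtain B \<eta> where B: "finite B" "\<forall>n. (bracket h ^^ n) y \<in> span B"
      and x: "bracket h x = \<eta> h *s x"
      using assms(1) by (auto simp: weight_space_def)
    have "(bracket h ^^ n) (c *s x + y) = (c * \<eta> h ^ n) *s x + (bracket h ^^ n) y" for n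
      by (induction n) (auto simp: bracket_add_right bracket_scale_right x mult.assoc mult.commute)
    moreover have "(c * \<eta> h ^ n) *s x + (bracket h ^^ n) y \<in> span (insert x B)" for n
      using B(2) span_mono[of B "insert x B"]
      by (intro span_add span_scale) (auto intro: span_base)
    ultimately show ?case using B(1) by (intro exI[of _ "insert x B"]) auto
  qed
qed

text \<open>The anti-involution becomes, up to sign, an automorphism exchanging the two halves.\<close>

lemma lie_automorphism_minus_anti_involution:
  assumes "anti_involution \<sigma>" shows "lie_automorphism (\<lambda>x. - \<sigma> x)"
proof -
  have lin: "Vector_Spaces.linear scale scale \<sigma>"
    and br: "\<And>x y. \<sigma> (bracket x y) = bracket (\<sigma> y) (\<sigma> x)" and inv: "\<And>x. \<sigma> (\<sigma> x) = x"
    using assms by (auto simp: anti_involution_def fun_eq_iff)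
  note vs = lin[unfolded Vector_Spaces.linear_iff]
  have neg: "\<sigma> (- x) = - \<sigma> x" for x
    using vs by (metis scale_minus_left scale_one)
  have "bij (\<lambda>x. - \<sigma> x)"
    by (rule o_bij[where g = "\<lambda>x. - \<sigma> x"]) (auto simp: neg inv)
  moreover have "- \<sigma> (bracket x y) = bracket (- \<sigma> x) (- \<sigma> y)" for x y
    using bracket_anticommute[of "\<sigma> y" "\<sigma> x"] by (simp add: br bracket_minus)
  ultimately show ?thesis
    using vs by (auto simp: lie_automorphism_def Vector_Spaces.linear_iff)
qed

end

section \<open>Leading terms in a triangular decomposition\<close>

locale triangular_lie_algebra = lie_algebra scale bracket + ordered_cone G r
  for scale :: "'f::field \<Rightarrow> 'a::ab_group_add \<Rightarrow> 'a" (infixr \<open>*s\<close> 75)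
    and bracket :: "'a \<Rightarrow> 'a \<Rightarrow> 'a" and G :: "('a \<Rightarrow> 'f) set" and r +
  fixes Lm H Lp :: "'a set" and \<sigma> :: "'a \<Rightarrow> 'a"
  assumes abelian: "abelian H"
    and subspaces: "subspace H" "subspace Lp"
    and Lp_bracket: "x \<in> Lp \<Longrightarrow> y \<in> Lp \<Longrightarrow> bracket x y \<in> Lp"
    and decomposition: "\<exists>a\<in>Lm. \<exists>b\<in>H. \<exists>c\<in>Lp. x = a + b + c"
    and weights: "G \<subseteq> dual_space H" "weights_on H Lp \<subseteq> G"
    and Lp_span: "Lp = span (\<Union>\<eta>\<in>weights_on H Lp. Lp \<inter> weight_space H \<eta>)"
    and \<sigma>: "anti_involution \<sigma>" "\<sigma> ` Lp = Lm" "h \<in> H \<Longrightarrow> \<sigma> h = h"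
begin

lemma \<sigma>_linear: "Vector_Spaces.linear scale scale \<sigma>"
  and \<sigma>_bracket: "\<sigma> (bracket x y) = bracket (\<sigma> y) (\<sigma> x)"
  and \<sigma>_involution: "\<sigma> (\<sigma> x) = x"
  using \<sigma>(1) by (auto simp: anti_involution_def fun_eq_iff)

lemma \<sigma>_sum: "\<sigma> (\<Sum>i\<in>I. f i) = (\<Sum>i\<in>I. \<sigma> (f i))"
  by (rule module_hom.sum[OF \<sigma>_linear[folded module_hom_iff_linear]])

lemma \<sigma>_zero: "\<sigma> 0 = 0"
  by (rule module_hom.zero[OF \<sigma>_linear[folded module_hom_iff_linear]])

lemma \<sigma>_weight_space:
  assumes "x \<in> weight_space H \<eta>" shows "\<sigma> x \<in> weight_space H (- \<eta>)"
  unfolding weight_space_def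
proof safe
  fix h assume h: "h \<in> H"
  have "bracket h (\<sigma> x) = \<sigma> (bracket x h)" using \<sigma>(3)[OF h] by (simp add: \<sigma>_bracket)
  also have "bracket x h = (- \<eta> h) *s x"
    using assms h bracket_anticommute[of x h] by (simp add: weight_space_def)
  also have "\<sigma> \<dots> = (- \<eta> h) *s \<sigma> x" using \<sigma>_linear unfolding Vector_Spaces.linear_iff by blast
  finally show "bracket h (\<sigma> x) = (- \<eta>) h *s \<sigma> x" by simp
qed

lemma Lp_decompose:
  assumes "c \<in> Lp"
  shows "\<exists>J f. finite J \<and> J \<subseteq> G \<and> (\<forall>j\<in>J. f j \<in> Lp \<inter> weight_space H j \<and> f j \<noteq> 0) \<and>
    c = (\<Sum>j\<in>J. f j)"
proof -
  have "c \<in> span (\<Union>\<eta>\<in>weights_on H Lp. Lp \<inter> weight_space H \<eta>)" using assms Lp_span by simp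
  from span_UN_decompose[OF this] show ?thesis
    using weights(2) subspace_inter[OF subspaces(2) subspace_weight_space] by (meson order_trans)
qed

definition lower_part :: "('a \<Rightarrow> 'f) \<Rightarrow> 'a set" where
  "lower_part \<mu> = span (\<Union>\<eta>\<in>{\<eta>\<in>dual_space H. \<eta> \<lhd> \<mu>}. weight_space H \<eta>)"

lemma lower_part_subspace: "subspace (lower_part \<mu>)"
  by (simp add: lower_part_def)

lemma lower_part_base:
  "\<eta> \<in> dual_space H \<Longrightarrow> \<eta> \<lhd> \<mu> \<Longrightarrow> x \<in> weight_space H \<eta> \<Longrightarrow> x \<in> lower_part \<mu>"
  unfolding lower_part_def by (rule span_base) auto

lemma lower_part_mono: "\<eta> \<lhd> \<mu> \<Longrightarrow> lower_part \<eta> \<subseteq> lower_part \<mu>"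
  unfolding lower_part_def by (rule span_mono) (use below_trans in blast)

lemma weight_vector_in_lower_part:
  assumes "\<mu> \<in> dual_space H" "v \<in> weight_space H \<mu>" "v \<in> lower_part \<mu>" shows "v = 0"
  by (rule weight_vector_in_span_other_weights[where \<Lambda> = "{\<eta>\<in>dual_space H. \<eta> \<lhd> \<mu>}"])
    (use assms below_irrefl in \<open>auto simp: lower_part_def\<close>)

lemma Lm_lower: assumes "a \<in> Lm" "\<gamma> \<in> G" shows "a \<in> lower_part \<gamma>"
proof -
  obtain c where c: "c \<in> Lp" "a = \<sigma> c" using assms \<sigma>(2) by auto
  obtain J f where J: "J \<subseteq> G" "\<forall>j\<in>J. f j \<in> Lp \<inter> weight_space H j" "c = (\<Sum>j\<in>J. f j)"
    using Lp_decompose[OF c(1)] by blast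
  have "\<sigma> (f j) \<in> lower_part \<gamma>" if "j \<in> J" for j
    using that J weights(1) assms(2)
    by (intro lower_part_base[of "- j"] dual_space_uminus uminus_below \<sigma>_weight_space) auto
  then show ?thesis unfolding c(2) J(3) \<sigma>_sum by (intro subspace_sum[OF lower_part_subspace])
qed

lemma H_weight_zero: "H \<subseteq> weight_space H 0"
  using abelian by (auto simp: abelian_def weight_space_def)

lemma H_lower: "b \<in> H \<Longrightarrow> \<gamma> \<in> G \<Longrightarrow> b \<in> lower_part \<gamma>"
  using lower_part_base[OF dual_space_zero zero_below] H_weight_zero by blast

lemma weight_vectors_span: "y \<in> span (\<Union>\<eta>. weight_space H \<eta>)"
proof -
  have base: "v \<in> span (\<Union>\<eta>. weight_space H \<eta>)" if "v \<in> weight_space H \<eta>" for v \<eta>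
    using that by (auto intro: span_base)
  have Lp: "c \<in> span (\<Union>\<eta>. weight_space H \<eta>)" "\<sigma> c \<in> span (\<Union>\<eta>. weight_space H \<eta>)"
    if c: "c \<in> Lp" for c
  proof -
    obtain J f where J: "\<forall>j\<in>J. f j \<in> Lp \<inter> weight_space H j" "c = (\<Sum>j\<in>J. f j)"
      using Lp_decompose[OF c] by blast
    show "c \<in> span (\<Union>\<eta>. weight_space H \<eta>)" "\<sigma> c \<in> span (\<Union>\<eta>. weight_space H \<eta>)"
      unfolding J(2) \<sigma>_sum using J(1) base \<sigma>_weight_space by (blast intro: span_sum)+
  qed
  obtain a b c where abc: "a \<in> Lm" "b \<in> H" "c \<in> Lp" "y = a + b + c"
    using decomposition by blast
  moreover obtain c' where "c' \<in> Lp" "a = \<sigma> c'" using abc(1) \<sigma>(2) by auto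
  ultimately show ?thesis using Lp base H_weight_zero by (auto intro!: span_add)
qed

lemma leading_term:
  assumes "c \<in> Lp" "c \<noteq> 0"
  shows "\<exists>\<gamma>\<in>G. \<exists>z\<in>Lp \<inter> weight_space H \<gamma>. z \<noteq> 0 \<and> c - z \<in> lower_part \<gamma>"
proof -
  obtain J f where J: "finite J" "J \<subseteq> G" "c = (\<Sum>j\<in>J. f j)"
    "\<forall>j\<in>J. f j \<in> Lp \<inter> weight_space H j \<and> f j \<noteq> 0"
    using Lp_decompose[OF assms(1)] by blast
  have "J \<noteq> {}" using J(3) assms(2) by auto
  then obtain \<gamma> where \<gamma>: "\<gamma> \<in> J" "\<forall>\<eta>\<in>J. \<eta> \<noteq> \<gamma> \<longrightarrow> \<eta> \<lhd> \<gamma>"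
    using finite_has_greatest[OF J(1) _ J(2)] by blast
  have "c - f \<gamma> = (\<Sum>j\<in>J - {\<gamma>}. f j)"
    using J(1,3) \<gamma>(1) by (simp add: sum_diff1)
  also have "\<dots> \<in> lower_part \<gamma>"
  proof (rule subspace_sum[OF lower_part_subspace])
    fix j assume "j \<in> J - {\<gamma>}"
    then show "f j \<in> lower_part \<gamma>"
      using J(2,4) \<gamma>(2) weights(1) by (intro lower_part_base[of j]) auto
  qed
  finally show ?thesis using J(2,4) \<gamma>(1) by blast
qed

text \<open>Expand the bracket of \<open>z + (x - z)\<close> and \<open>y + (w - y)\<close>: every product other than \<open>[z, y]\<close>
  has a lower factor, and \<open>\<lhd>\<close> is compatible with addition.\<close>

lemma bracket_leading_term:
  assumes \<gamma>: "\<gamma> \<in> dual_space H" "\<beta> \<in> dual_space H"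
    and z: "z \<in> weight_space H \<gamma>" "y \<in> weight_space H \<beta>"
    and low: "x - z \<in> lower_part \<gamma>" "w - y \<in> lower_part \<beta>"
  shows "bracket x w - bracket z y \<in> lower_part (\<gamma> + \<beta>)"
proof -
  let ?W = "\<lambda>\<mu>. \<Union>\<eta>\<in>{\<eta>\<in>dual_space H. \<eta> \<lhd> \<mu>}. weight_space H \<eta>"
  have W: "bracket u v \<in> lower_part (\<gamma> + \<beta>)"
    if "u \<in> weight_space H \<eta>" "v \<in> weight_space H \<kappa>" "\<eta> \<in> dual_space H" "\<kappa> \<in> dual_space H"
      "\<eta> + \<kappa> \<lhd> \<gamma> + \<beta>" for u v \<eta> \<kappa>
    using that by (intro lower_part_base[of "\<eta> + \<kappa>"] dual_space_add bracket_weight_space)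
  have 1: "bracket (x - z) y \<in> lower_part (\<gamma> + \<beta>)"
    unfolding lower_part_def
    by (rule bracket_span[where A = "?W \<gamma>" and B = "{y}"])
      (use low(1) z W \<gamma> below_add_right in
        \<open>auto simp: lower_part_def[symmetric] intro: span_base\<close>)
  have 2: "bracket z (w - y) \<in> lower_part (\<gamma> + \<beta>)"
    unfolding lower_part_def
    by (rule bracket_span[where A = "{z}" and B = "?W \<beta>"])
      (use low(2) z W \<gamma> below_add_left in
        \<open>auto simp: lower_part_def[symmetric] intro: span_base\<close>)
  have 3: "bracket (x - z) (w - y) \<in> lower_part (\<gamma> + \<beta>)"
    unfolding lower_part_def
    by (rule bracket_span[where A = "?W \<gamma>" and B = "?W \<beta>"])
      (use low W \<gamma> below_add in
        \<open>auto simp: lower_part_def[symmetric] intro: span_base\<close>)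
  have "bracket x w = bracket ((x - z) + z) ((w - y) + y)" by simp
  also have "\<dots> = bracket (x - z) (w - y) + bracket (x - z) y + bracket z (w - y) + bracket z y"
    unfolding bracket_add_left bracket_add_right by (simp only: ac_simps)
  finally have "bracket x w - bracket z y
      = bracket (x - z) (w - y) + bracket (x - z) y + bracket z (w - y)" by simp
  then show ?thesis using 1 2 3 by (simp add: subspace_add[OF lower_part_subspace])
qed

text \<open>Vectors with strictly increasing leading weights are linearly independent, since each of them
  lies outside the part spanned by lower weights, which contains all its predecessors.\<close>

lemma increasing_leading_terms_unbounded:
  assumes \<mu>: "\<And>n. \<mu> n \<in> dual_space H" "\<And>n. \<mu> n \<lhd> \<mu> (Suc n)"
    and z: "\<And>n. z n \<in> weight_space H (\<mu> n)" "\<And>n. z n \<noteq> 0"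
    and w: "\<And>n. w n - z n \<in> lower_part (\<mu> n)"
    and B: "finite B"
  shows "\<exists>n. w n \<notin> span B"
proof (rule ccontr)
  assume "\<not> ?thesis"
  then have inB: "w n \<in> span B" for n by auto
  have notin: "w n \<notin> lower_part (\<mu> n)" for n
  proof
    assume "w n \<in> lower_part (\<mu> n)"
    then have "w n - (w n - z n) \<in> lower_part (\<mu> n)"
      using w subspace_diff[OF lower_part_subspace] by blast
    then show False using weight_vector_in_lower_part[OF \<mu>(1) z(1)] z(2) by simp
  qed
  have step: "w n \<in> lower_part (\<mu> (Suc n))" for n
  proof -
    have "z n \<in> lower_part (\<mu> (Suc n))" using lower_part_base[OF \<mu>(1) \<mu>(2) z(1)] .
    moreover have "w n - z n \<in> lower_part (\<mu> (Suc n))" using w lower_part_mono[OF \<mu>(2)] by blast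
    ultimately have "(w n - z n) + z n \<in> lower_part (\<mu> (Suc n))"
      using subspace_add[OF lower_part_subspace] by blast
    then show ?thesis by simp
  qed
  have earlier: "w ` {..<n} \<subseteq> lower_part (\<mu> n)" for n
  proof (induction n)
    case (Suc n)
    then have "w ` {..<n} \<subseteq> lower_part (\<mu> (Suc n))" using lower_part_mono[OF \<mu>(2)[of n]] by blast
    then show ?case using step[of n] by (auto simp: lessThan_Suc)
  qed simp
  have new: "w n \<notin> span (w ` {..<n})" for n
    using notin span_minimal[OF earlier lower_part_subspace] by blast
  have indep: "independent (w ` {..<n}) \<and> card (w ` {..<n}) = n" for n
  proof (induction n)
    case (Suc n)
    have "w n \<notin> w ` {..<n}" using new[of n] by (metis span_base)
    then show ?case
      using Suc new[of n] independent_insertI by (simp add: lessThan_Suc card_insert_if)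
  qed (simp add: independent_empty)
  have "Suc (card B) \<le> card B"
  proof -
    have "w ` {..<Suc (card B)} \<subseteq> span B" using inB by auto
    then show ?thesis using independent_span_bound[OF B] indep[of "Suc (card B)"] by metis
  qed
  then show False by simp
qed

section \<open>The Cartan part consists of the ad-locally finite elements\<close>

context
  assumes csc: "completely_self_centralizing Lp"
begin

text \<open>Completely self-centralizing algebras have dimension greater than one, so weight vectors
  outside any given line exist.\<close>

lemma weight_vector_off_line:
  assumes "z \<in> Lp"
  shows "\<exists>\<beta>\<in>G. \<exists>y\<in>Lp \<inter> weight_space H \<beta>. y \<notin> span {z}"
proof (rule ccontr)
  assume "\<not> ?thesis"
  then have "(\<Union>\<eta>\<in>weights_on H Lp. Lp \<inter> weight_space H \<eta>) \<subseteq> span {z}"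
    using weights(2) by blast
  then have "Lp \<subseteq> span {z}" using Lp_span span_minimal[OF _ subspace_span] by metis
  moreover have "span {z} \<subseteq> Lp" using assms subspaces(2) by (simp add: span_minimal)
  ultimately have Lp: "Lp = span {z}" by auto
  then have "finite_dimensional Lp" unfolding finite_dimensional_def by blast
  then have "dim Lp > 1" using csc by (simp add: completely_self_centralizing_def)
  moreover have "dim Lp \<le> 1" using dim_le_card[of Lp "{z}"] Lp by simp
  ultimately show False by simp
qed

lemma bracket_eq_zero_in_span:
  assumes "z \<in> Lp" "z \<noteq> 0" "y \<in> Lp" "bracket z y = 0" shows "y \<in> span {z}"
proof -
  have "self_centralizing Lp z" using csc assms by (simp add: completely_self_centralizing_def)
  then obtain c where "y = c *s z" using assms by (auto simp: self_centralizing_def)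
  then show ?thesis by (simp add: span_scale span_base)
qed

text \<open>A nonzero leading term \<open>z\<close> of \<open>x\<close> produces leading terms \<open>(ad z)\<^sup>n y\<close> in the iterates
  \<open>(ad x)\<^sup>n y\<close>, whose weights increase without end.\<close>

lemma not_ad_locally_finite:
  assumes \<gamma>: "\<gamma> \<in> G" and z: "z \<in> Lp" "z \<in> weight_space H \<gamma>" "z \<noteq> 0"
    and x: "x - z \<in> lower_part \<gamma>"
  shows "\<not> ad_locally_finite x"
proof
  assume lf: "ad_locally_finite x"
  obtain \<beta> y where y: "\<beta> \<in> G" "y \<in> Lp" "y \<in> weight_space H \<beta>" "y \<notin> span {z}"
    using weight_vector_off_line[OF z(1)] by blast
  obtain B where B: "finite B" "\<And>n. (bracket x ^^ n) y \<in> span B"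
    using lf by (auto simp: ad_locally_finite_def)
  define \<mu> where "\<mu> n = (((+) \<gamma>) ^^ n) \<beta>" for n
  define u where "u n = (bracket z ^^ n) y" for n
  define w where "w n = (bracket x ^^ n) y" for n
  have \<mu>_Suc: "\<mu> (Suc n) = \<gamma> + \<mu> n" for n by (simp add: \<mu>_def)
  have \<mu>_G: "\<mu> n \<in> G" for n
  proof (induction n)
    case 0 then show ?case by (simp add: \<mu>_def y)
  next
    case (Suc n) then show ?case unfolding \<mu>_Suc by (rule add_closed[OF \<gamma>])
  qed
  have dual: "\<gamma> \<in> dual_space H" "\<mu> n \<in> dual_space H" for n using \<mu>_G \<gamma> weights(1) by auto
  have u: "u n \<in> Lp \<and> u n \<in> weight_space H (\<mu> n) \<and> u n \<notin> span {z}" for n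
  proof (induction n)
    case 0 then show ?case using y by (simp add: u_def \<mu>_def)
  next
    case (Suc n)
    have eq: "u (Suc n) = bracket z (u n)" by (simp add: u_def)
    have nz: "u (Suc n) \<noteq> 0" using bracket_eq_zero_in_span[OF z(1,3), of "u n"] Suc eq by auto
    have wt: "u (Suc n) \<in> weight_space H (\<gamma> + \<mu> n)"
      unfolding eq using z Suc by (intro bracket_weight_space) auto
    have "u (Suc n) \<notin> span {z}"
    proof
      \<comment> \<open>A multiple of \<open>z\<close> would have weight \<open>\<gamma>\<close>, whereas \<open>\<gamma> + \<mu> n > \<gamma>\<close>.\<close>
      assume "u (Suc n) \<in> span {z}"
      then have "u (Suc n) \<in> weight_space H \<gamma>"
        using span_minimal[of "{z}" "weight_space H \<gamma>"] z(2) subspace_weight_space by blast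
      then have "u (Suc n) \<in> lower_part (\<gamma> + \<mu> n)"
        using lower_part_base[OF dual(1)] below_of_order add_above[OF \<gamma> \<mu>_G] by metis
      then show False
        using weight_vector_in_lower_part[OF dual_space_add[OF dual] wt] nz by blast
    qed
    then show ?case using wt Lp_bracket[OF z(1), of "u n"] Suc unfolding \<mu>_Suc eq by blast
  qed
  have "w n - u n \<in> lower_part (\<mu> n)" for n
  proof (induction n)
    case 0 then show ?case by (simp add: w_def u_def subspace_0[OF lower_part_subspace])
  next
    case (Suc n)
    have "bracket x (w n) - bracket z (u n) \<in> lower_part (\<gamma> + \<mu> n)"
      using dual z(2) u x Suc by (intro bracket_leading_term) auto
    then show ?case unfolding \<mu>_Suc by (simp only: w_def u_def funpow.simps comp_apply)
  qed
  moreover have "\<mu> n \<lhd> \<mu> (Suc n)" for n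
    using below_add_right[OF zero_below[OF \<gamma>], of "\<mu> n"] by (simp add: \<mu>_Suc)
  moreover have "u n \<noteq> 0" for n using u[of n] by (metis span_zero)
  ultimately have "\<exists>n. w n \<notin> span B"
    using dual(2) u B(1) by (intro increasing_leading_terms_unbounded[of \<mu> u]) auto
  then show False using B(2) by (simp add: w_def)
qed

lemma ad_locally_finite_Lp_part:
  assumes "ad_locally_finite (a + b + c)" "a \<in> Lm" "b \<in> H" "c \<in> Lp" shows "c = 0"
proof (rule ccontr)
  assume "c \<noteq> 0"
  then obtain \<gamma> z where z: "\<gamma> \<in> G" "z \<in> Lp" "z \<in> weight_space H \<gamma>" "z \<noteq> 0"
    "c - z \<in> lower_part \<gamma>"
    using leading_term[OF assms(4)] by blast
  have "a + b + (c - z) \<in> lower_part \<gamma>"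
    using Lm_lower H_lower assms z by (intro subspace_add[OF lower_part_subspace]) auto
  then have "(a + b + c) - z \<in> lower_part \<gamma>" by (simp add: add_diff_eq)
  then show False using not_ad_locally_finite z assms(1) by blast
qed

lemma H_eq_ad_locally_finite: "H = {x. ad_locally_finite x}"
proof
  show "H \<subseteq> {x. ad_locally_finite x}"
    using ad_locally_finite_of_weight_span[OF _ weight_vectors_span] by blast
next
  show "{x. ad_locally_finite x} \<subseteq> H"
  proof safe
    fix x assume x: "ad_locally_finite x"
    obtain a b c where abc: "a \<in> Lm" "b \<in> H" "c \<in> Lp" "x = a + b + c"
      using decomposition by blast
    then have "c = 0" using ad_locally_finite_Lp_part x by blast
    obtain a' where a': "a' \<in> Lp" "a = \<sigma> a'" using abc(1) \<sigma>(2) by auto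
    have "- \<sigma> x = 0 + (- b) + (- a')"
      using abc \<open>c = 0\<close> a' \<sigma>_linear \<sigma>(3) \<sigma>_involution by (auto simp: Vector_Spaces.linear_iff)
    moreover have "ad_locally_finite (- \<sigma> x)"
      using ad_locally_finite_automorphism[OF lie_automorphism_minus_anti_involution[OF \<sigma>(1)] x] .
    moreover have "0 \<in> Lm"
      using \<sigma>(2) \<sigma>_zero subspace_0[OF subspaces(2)] by (metis image_eqI)
    ultimately have "- a' = 0"
      using abc(2) a'(1) subspaces ad_locally_finite_Lp_part[of 0 "- b" "- a'"]
      by (simp add: subspace_neg)
    then have "a = 0" using a'(2) \<sigma>_zero by simp
    then show "x \<in> H" using abc \<open>c = 0\<close> by simp
  qed
qed

lemma automorphism_preserves_H: "lie_automorphism \<tau> \<Longrightarrow> h \<in> H \<Longrightarrow> \<tau> h \<in> H"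
  using H_eq_ad_locally_finite ad_locally_finite_automorphism by blast

end

end

section \<open>Automorphisms permute the weight spaces\<close>

context lie_algebra
begin

lemma automorphism_dual_space:
  assumes \<tau>: "lie_automorphism \<tau>" and H: "\<tau> ` H \<subseteq> H" "inv \<tau> ` H \<subseteq> H" and \<alpha>: "\<alpha> \<in> dual_space H"
  shows "\<alpha> \<circ> inv \<tau> \<in> dual_space H"
proof -
  have lin: "inv \<tau> (x + y) = inv \<tau> x + inv \<tau> y" "inv \<tau> (c *s x) = c *s inv \<tau> x" for c x y
    using lie_automorphism_inv[OF \<tau>] by (simp_all add: lie_automorphism_def Vector_Spaces.linear_iff)
  have "inv \<tau> x \<notin> H" if "x \<notin> H" for x
    using that H(1) \<tau> by (metis bij_inv_eq_iff image_subset_iff lie_automorphism_def)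
  then show ?thesis
    using \<alpha> H(2) by (simp add: dual_space_def lin image_subset_iff)
qed

lemma automorphism_weight_space:
  assumes \<tau>: "lie_automorphism \<tau>" and H: "inv \<tau> ` H \<subseteq> H"
  shows "\<tau> ` weight_space H \<alpha> \<subseteq> weight_space H (\<alpha> \<circ> inv \<tau>)"
proof safe
  fix x assume x: "x \<in> weight_space H \<alpha>"
  have lin: "\<tau> (c *s y) = c *s \<tau> y" and br: "\<tau> (bracket y z) = bracket (\<tau> y) (\<tau> z)"
    and r: "\<tau> (inv \<tau> y) = y" for c y z
    using \<tau> by (simp_all add: lie_automorphism_def Vector_Spaces.linear_iff bij_def surj_f_inv_f)
  have "bracket h (\<tau> x) = \<alpha> (inv \<tau> h) *s \<tau> x" if h: "h \<in> H" for h
  proof -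
    have "bracket h (\<tau> x) = \<tau> (bracket (inv \<tau> h) x)" by (simp add: br r)
    also have "bracket (inv \<tau> h) x = \<alpha> (inv \<tau> h) *s x"
      using x h H by (auto simp: weight_space_def)
    finally show ?thesis by (simp add: lin)
  qed
  then show "\<tau> x \<in> weight_space H (\<alpha> \<circ> inv \<tau>)" by (simp add: weight_space_def)
qed

lemma weakly_triangular_imp_triangular:
  assumes "weakly_triangular_decomposition Lm H Lp Gp"
  shows "\<exists>r \<sigma>. triangular_lie_algebra scale bracket Gp r Lm H Lp \<sigma>"
proof -
  have a: "subalgebra H" "subalgebra Lp" "abelian H" "Gp \<subseteq> dual_space H"
      "weights_on H Lp \<subseteq> Gp - {0}"
      "internal_direct_sum (weights_on H Lp) (\<lambda>\<alpha>. Lp \<inter> weight_space H \<alpha>) Lp"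
    and dec: "\<And>x. \<exists>!(a, b, c). a \<in> Lm \<and> b \<in> H \<and> c \<in> Lp \<and> x = a + b + c"
    and exs: "\<exists>\<sigma>. anti_involution \<sigma> \<and> \<sigma> ` Lp = Lm \<and> (\<forall>h\<in>H. \<sigma> h = h)"
    and exr: "\<exists>r. linear_order_on Gp r \<and>
        (\<forall>\<alpha>\<in>Gp. \<forall>\<beta>\<in>Gp. (\<alpha>, \<alpha> + \<beta>) \<in> r \<and> \<alpha> + \<beta> \<noteq> \<alpha>) \<and>
        (\<forall>\<alpha>\<in>Gp. \<forall>\<beta>\<in>Gp. \<forall>\<gamma>\<in>Gp. (\<gamma>, \<beta>) \<in> r \<longrightarrow> (\<alpha> + \<gamma>, \<alpha> + \<beta>) \<in> r)"
    using assms unfolding weakly_triangular_decomposition_def 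
    by - ((elim conjE, assumption) | (elim conjE, erule spec))+
  obtain r where r: "linear_order_on Gp r"
    "\<forall>\<alpha>\<in>Gp. \<forall>\<beta>\<in>Gp. (\<alpha>, \<alpha> + \<beta>) \<in> r \<and> \<alpha> + \<beta> \<noteq> \<alpha>"
    "\<forall>\<alpha>\<in>Gp. \<forall>\<beta>\<in>Gp. \<forall>\<gamma>\<in>Gp. (\<gamma>, \<beta>) \<in> r \<longrightarrow> (\<alpha> + \<gamma>, \<alpha> + \<beta>) \<in> r"
    using exr by (elim exE conjE)
  have rG: "r \<subseteq> Gp \<times> Gp" using r(1) by (simp add: order_on_defs)
  obtain \<sigma> where \<sigma>: "anti_involution \<sigma>" "\<sigma> ` Lp = Lm" "\<forall>h\<in>H. \<sigma> h = h"
    using exs by (elim exE conjE)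
  have dec: "\<exists>a\<in>Lm. \<exists>b\<in>H. \<exists>c\<in>Lp. x = a + b + c" for x
    using ex1_implies_ex[OF dec[of x]] by auto
  have "triangular_lie_algebra scale bracket Gp r Lm H Lp \<sigma>"
  proof unfold_locales
    show "abelian H" "subspace H" "subspace Lp"
      using a(1-3) by (auto simp: subalgebra_def)
    show "Lp = span (\<Union>\<eta>\<in>weights_on H Lp. Lp \<inter> weight_space H \<eta>)"
      using a(6) unfolding internal_direct_sum_def by (elim conjE)
    show "(\<alpha>, \<alpha> + \<beta>) \<in> r \<and> \<alpha> + \<beta> \<noteq> \<alpha>" if "\<alpha> \<in> Gp" "\<beta> \<in> Gp" for \<alpha> \<beta> using that r by blast
    show "(\<alpha> + \<gamma>, \<alpha> + \<beta>) \<in> r" if "\<alpha> \<in> Gp" "(\<gamma>, \<beta>) \<in> r" for \<alpha> \<beta> \<gamma> using that r rG by blast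
    show "bracket x y \<in> Lp" if "x \<in> Lp" "y \<in> Lp" for x y
      using a(2) that unfolding subalgebra_def by blast
    show "Gp \<subseteq> dual_space H" "weights_on H Lp \<subseteq> Gp" using a(4,5) by auto
    show "linear_order_on Gp r" by (rule r(1))
    show "\<exists>a\<in>Lm. \<exists>b\<in>H. \<exists>c\<in>Lp. x = a + b + c" for x by (rule dec)
    show "anti_involution \<sigma>" "\<sigma> ` Lp = Lm" by (fact \<sigma>)+
    show "\<sigma> h = h" if "h \<in> H" for h using \<sigma>(3) that by blast
  qed
  then show ?thesis by blast
qed

end

theorem proposition6p1:
  fixes scale :: "'f::field \<Rightarrow> 'a::ab_group_add \<Rightarrow> 'a"
    and bracket :: "'a \<Rightarrow> 'a \<Rightarrow> 'a"
    and Lm H Lp :: "'a set"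
    and Gp :: "('a \<Rightarrow> 'f) set"
    and \<tau> :: "'a \<Rightarrow> 'a"
  assumes "lie_algebra scale bracket"
    and "lie_algebra.regular_weakly_triangular_decomposition scale bracket Lm H Lp Gp"
    and "lie_algebra.completely_self_centralizing scale bracket Lp"
    and "lie_algebra.lie_automorphism scale bracket \<tau>"
  shows "\<tau> ` H \<subseteq> H \<and>
    (\<forall>\<alpha> \<in> uminus ` Gp \<union> {0} \<union> Gp.
       \<alpha> \<circ> inv \<tau> \<in> lie_algebra.dual_space scale H \<and>
       \<tau> ` lie_algebra.weight_space scale bracket H \<alpha>
         \<subseteq> lie_algebra.weight_space scale bracket H (\<alpha> \<circ> inv \<tau>))"
proof -
  interpret lie_algebra scale bracket by (fact assms(1))
  have wtd: "weakly_triangular_decomposition Lm H Lp Gp"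
    using assms(2) by (simp add: regular_weakly_triangular_decomposition_def)
  then obtain r \<sigma> where "triangular_lie_algebra scale bracket Gp r Lm H Lp \<sigma>"
    using weakly_triangular_imp_triangular by blast
  then interpret triangular_lie_algebra scale bracket Gp r Lm H Lp \<sigma> .
  have H: "\<tau> ` H \<subseteq> H" "inv \<tau> ` H \<subseteq> H"
    using automorphism_preserves_H[OF assms(3)] assms(4) lie_automorphism_inv by blast+
  have "\<alpha> \<in> dual_space H" if "\<alpha> \<in> uminus ` Gp \<union> {0} \<union> Gp" for \<alpha>
    using that weights(1) dual_space_uminus dual_space_zero by auto
  then show ?thesis
    by (intro conjI ballI H(1) automorphism_dual_space[OF assms(4) H]
        automorphism_weight_space[OF assms(4) H(2)])
qed

end
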